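(* Let $\mu,\nu$ be positive Borel measures with compact support in $\mathbb{C}^d$, let $n\ge 0$ be an integer for which $k_n^\mu$ is defined, and suppose that for some $\epsilon\in(0,1)$ $$(1-\epsilon)\,\|p\|_{2,\mu}^2\le\|p\|_{2,\nu}^2\le(1+\epsilon)\,\|p\|_{2,\mu}^2$$ for all polynomials $p$ of degree at most $k_n^\mu$. Then for all $z,w\in\mathbb{C}^d$: $$(1-\epsilon)K_n^\nu(z,z)\le K_n^\mu(z,z)\le(1+\epsilon)K_n^\nu(z,z),$$ $$|K_n^\mu(z,w)-K_n^\nu(z,w)|\le\epsilon\sqrt{K_n^\nu(z,z)}\sqrt{K_n^\nu(w,w)},$$ $$|C_n^\mu(z,w)-C_n^\nu(z,w)|\le2\epsilon.$$
   Context: Fix $d\ge1$ and an enumeration $\alpha(0)=0,\alpha(1),\alpha(2),\dots$ of all multi-indices in $\mathbb{N}^d$ such that multiplication by any variable increases the order: if $z_jz^{\alpha(n)}=z^{\alpha(k)}$ then $k>n$. For a polynomial $p$ write $\deg p=k$ if $p$ is a linear combination of $z^{\alpha(0)},\dots,z^{\alpha(k)}$ with nonzero coefficient of $z^{\alpha(k)}$ ("degree" always has this meaning). For a nonzero positive Borel measure $\mu$ with compact support in $\mathbb{C}^d$ put $\langle f,g\rangle_{2,\mu}=\int f\overline g\,d\mu$, $\|f\|_{2,\mu}=\langle f,f\rangle_{2,\mu}^{1/2}$, $v_k(z)=(z^{\alpha(0)},\dots,z^{\alpha(k)})$ (row vector), $\widetilde M_k(\mu)=\int v_k(z)^*v_k(z)\,d\mu(z)$,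 and $k_n^\mu=\min\{k\ge0:\operatorname{rank}\widetilde M_k(\mu)=n+1\}$. The monomials $z^{\alpha(k_0^\mu)},z^{\alpha(k_1^\mu)},\dots$ are linearly independent in $L^2(\mu)$, and the orthonormal polynomials $p_0^\mu,p_1^\mu,\dots$ are obtained from them by Gram–Schmidt: $p_n^\mu\in\operatorname{span}\{z^{\alpha(k_j^\mu)}:0\le j\le n\}$, $\deg p_n^\mu=k_n^\mu$, with positive leading coefficient. The Christoffel–Darboux kernel is $K_n^\mu(z,w)=\sum_{j=0}^np_j^\mu(z)\overline{p_j^\mu(w)}$, and the cosine function is $C_n^\mu(z,w)=K_n^\mu(z,w)/\big(\sqrt{K_n^\mu(z,z)}\sqrt{K_n^\mu(w,w)}\big)$. (Under the hypothesis, $k_n^\nu=k_n^\mu$, so $K_n^\nu$ is defined.) *)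

theory Defs
  imports "HOL-Analysis.Analysis" "Jordan_Normal_Form.DL_Rank"
begin

text \<open>
  Points of \<open>\<complex>\<^sup>d\<close> have type \<open>complex ^ 'd\<close> with \<open>d = CARD('d)\<close>, and multi-indices have
  type \<open>nat ^ 'd\<close>. Components are written with \<open>vec_nth\<close>, because the infix notation for it
  clashes with the one for the vectors of Jordan_Normal_Form.
\<close>

definition monomial :: "nat ^ 'd \<Rightarrow> complex ^ 'd \<Rightarrow> complex" where
  "monomial a z = (\<Prod>j\<in>UNIV. vec_nth z j ^ vec_nth a j)"

text \<open>\<open>axis j 1\<close> is the multi-index of the variable \<open>z\<^sub>j\<close>.\<close>

definition monomial_enumeration :: "(nat \<Rightarrow> nat ^ 'd) \<Rightarrow> bool" where
  "monomial_enumeration \<alpha> \<longleftrightarrow> bij \<alpha> \<and> \<alpha> 0 = 0 \<and>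
     (\<forall>n k j. axis j 1 + \<alpha> n = \<alpha> k \<longrightarrow> k > n)"

text \<open>
  Polynomials are identified with the functions they induce on \<open>\<complex>\<^sup>d\<close>. The zero polynomial
  has no degree.
\<close>

definition has_degree ::
    "(nat \<Rightarrow> nat ^ 'd) \<Rightarrow> (complex ^ 'd \<Rightarrow> complex) \<Rightarrow> nat \<Rightarrow> bool" where
  "has_degree \<alpha> p k \<longleftrightarrow>
     (\<exists>c. c k \<noteq> 0 \<and> p = (\<lambda>z. \<Sum>i\<le>k. c i * monomial (\<alpha> i) z))"

definition supp_measure :: "'a::topological_space measure \<Rightarrow> 'a set" where
  "supp_measure \<mu> = {x. \<forall>U. open U \<longrightarrow> x \<in> U \<longrightarrow> emeasure \<mu> U > 0}"

text \<open>
  A Borel measure is understood to be finite on compact sets, so one with compact support is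
  finite.
\<close>

definition compact_borel_measure :: "'a::topological_space measure \<Rightarrow> bool" where
  "compact_borel_measure \<mu> \<longleftrightarrow>
     sets \<mu> = sets borel \<and> finite_measure \<mu> \<and> compact (supp_measure \<mu>)"

definition inner_L2 ::
    "'a measure \<Rightarrow> ('a \<Rightarrow> complex) \<Rightarrow> ('a \<Rightarrow> complex) \<Rightarrow> complex" where
  "inner_L2 \<mu> f g = (\<integral>z. f z * cnj (g z) \<partial>\<mu>)"

definition norm_L2 :: "'a measure \<Rightarrow> ('a \<Rightarrow> complex) \<Rightarrow> real" where
  "norm_L2 \<mu> f = sqrt (Re (inner_L2 \<mu> f f))"

definition moment_matrix ::
    "(nat \<Rightarrow> nat ^ 'd) \<Rightarrow> (complex ^ 'd) measure \<Rightarrow> nat \<Rightarrow> complex mat" where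
  "moment_matrix \<alpha> \<mu> k = mat (k + 1) (k + 1)
     (\<lambda>(i, j). \<integral>z. cnj (monomial (\<alpha> i) z) * monomial (\<alpha> j) z \<partial>\<mu>)"

text \<open>The first argument of \<open>vec_space.rank\<close> is the number of rows.\<close>

definition moment_rank ::
    "(nat \<Rightarrow> nat ^ 'd) \<Rightarrow> (complex ^ 'd) measure \<Rightarrow> nat \<Rightarrow> nat" where
  "moment_rank \<alpha> \<mu> k = vec_space.rank (k + 1) (moment_matrix \<alpha> \<mu> k)"

definition index_defined ::
    "(nat \<Rightarrow> nat ^ 'd) \<Rightarrow> (complex ^ 'd) measure \<Rightarrow> nat \<Rightarrow> bool" where
  "index_defined \<alpha> \<mu> n \<longleftrightarrow> (\<exists>k. moment_rank \<alpha> \<mu> k = n + 1)"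

definition index ::
    "(nat \<Rightarrow> nat ^ 'd) \<Rightarrow> (complex ^ 'd) measure \<Rightarrow> nat \<Rightarrow> nat" where
  "index \<alpha> \<mu> n = (LEAST k. moment_rank \<alpha> \<mu> k = n + 1)"

text \<open>
  Gram--Schmidt with normalisation. The coefficient of the leading monomial is the inverse of
  the norm of \<open>q\<close>, hence positive. Meaningful only if \<open>index_defined \<alpha> \<mu> n\<close>.
\<close>

fun orthopoly ::
    "(nat \<Rightarrow> nat ^ 'd) \<Rightarrow> (complex ^ 'd) measure \<Rightarrow> nat \<Rightarrow> complex ^ 'd \<Rightarrow> complex" where
  "orthopoly \<alpha> \<mu> n =
     (let m = monomial (\<alpha> (index \<alpha> \<mu> n));
          q = (\<lambda>z. m z - (\<Sum>j<n. inner_L2 \<mu> m (orthopoly \<alpha> \<mu> j) * orthopoly \<alpha> \<mu> j z))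
      in (\<lambda>z. q z / of_real (norm_L2 \<mu> q)))"

declare orthopoly.simps [simp del]

definition CD_kernel ::
    "(nat \<Rightarrow> nat ^ 'd) \<Rightarrow> (complex ^ 'd) measure \<Rightarrow> nat \<Rightarrow> complex ^ 'd \<Rightarrow> complex ^ 'd \<Rightarrow> complex"
  where
  "CD_kernel \<alpha> \<mu> n z w = (\<Sum>j\<le>n. orthopoly \<alpha> \<mu> j z * cnj (orthopoly \<alpha> \<mu> j w))"

text \<open>\<open>CD_kernel \<alpha> \<mu> n z z\<close> is a sum of squared moduli, so taking \<open>Re\<close> only changes its type.\<close>

definition CD_diag ::
    "(nat \<Rightarrow> nat ^ 'd) \<Rightarrow> (complex ^ 'd) measure \<Rightarrow> nat \<Rightarrow> complex ^ 'd \<Rightarrow> real" where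
  "CD_diag \<alpha> \<mu> n z = Re (CD_kernel \<alpha> \<mu> n z z)"

definition cosine_fun ::
    "(nat \<Rightarrow> nat ^ 'd) \<Rightarrow> (complex ^ 'd) measure \<Rightarrow> nat \<Rightarrow> complex ^ 'd \<Rightarrow> complex ^ 'd \<Rightarrow> complex"
  where
  "cosine_fun \<alpha> \<mu> n z w =
     CD_kernel \<alpha> \<mu> n z w / of_real (sqrt (CD_diag \<alpha> \<mu> n z) * sqrt (CD_diag \<alpha> \<mu> n w))"

end

theory Submission
  imports Defs
begin

text \<open>
  Let \<open>W\<close> be the space of polynomials spanned by the orthonormal polynomials
  \<open>p\<^sub>0, \<dots>, p\<^sub>n\<close> of \<open>\<mu>\<close>. On \<open>W\<close> the norm of \<open>L\<^sup>2(\<mu>)\<close> is a Hilbert norm, and for a linear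
  functional \<open>\<Lambda>\<close> on \<open>W\<close> the squared dual norm is \<open>\<Sum>\<^sub>j \<bar>\<Lambda> p\<^sub>j\<bar>\<^sup>2\<close>. For \<open>\<Lambda> p = a p(z) + b p(w)\<close> this is the
  Hermitian form in \<open>(a, b)\<close> with the values of the Christoffel--Darboux kernel at \<open>z\<close> and \<open>w\<close> as
  coefficients. Everything follows from a comparison of these forms for \<open>\<mu>\<close> and \<open>\<nu>\<close>.

  To make the comparison possible, both measures must give the same \<open>W\<close>. The rank of the moment
  matrix of order \<open>k\<close> is the number of degrees \<open>j \<le> k\<close> that are new, in the sense that no
  polynomial of degree \<open>j\<close> has norm zero: vanishing combinations of the columns are null polynomials,
  so the new degrees are the pivot columns (\<open>rank_eq_card_pivots\<close>, \<open>moment_rank_eq\<close>).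
  The hypothesis makes the null polynomials
  of degree at most \<open>index \<alpha> \<mu> n\<close> the same for \<open>\<mu>\<close> and \<open>\<nu>\<close>, so the new degrees up to
  there are the same, and so are the indices of the monomials that enter Gram--Schmidt (\<open>index_eq\<close>).
  These monomials span \<open>W\<close> for either measure (\<open>orthopoly_in_orthopoly\<close>).

  The norms of \<open>\<mu>\<close> and \<open>\<nu>\<close> on \<open>W\<close> being comparable, the dual norms are comparable in the opposite
  direction (\<open>functional_norm_le\<close>): the form of \<open>\<mu>\<close> lies between \<open>1 - \<epsilon>\<close> and \<open>1 + \<epsilon>\<close> times that of
  \<open>\<nu>\<close>. The case \<open>b = 0\<close> is the bound on the diagonal. For the bound on the kernel off the
  diagonal, the difference of the forms is at most \<open>\<epsilon>\<close> times the form of \<open>\<nu>\<close>, and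
  polarisation transfers this to the off-diagonal entry (\<open>hermitian_perturbation_le\<close>). The bound
  on the cosine functions is a consequence of these two and of the Cauchy--Schwarz inequality
  (\<open>cosine_difference_le\<close>).
\<close>

section \<open>The rank of a matrix as its number of pivot columns\<close>

text \<open>
  These are the columns that are not linear combinations of the columns to their left,
  written as a condition on vanishing combinations with a nonzero last coefficient. In this form
  it matches \<open>has_degree\<close>.
\<close>

definition pivots :: "'a::field mat \<Rightarrow> nat set" where
  "pivots A = {j. j < dim_col A \<and>
     (\<forall>c. c j \<noteq> 0 \<longrightarrow> (\<exists>i<dim_row A. (\<Sum>l\<le>j. c l * A $$ (i, l)) \<noteq> 0))}"

lemma finite_pivots: "finite (pivots A)"
  unfolding pivots_def by simp

lemma pivots_sum_nonzero:
  assumes "j \<in> pivots A" and "c j \<noteq> 0"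
  obtains i where "i < dim_row A" and "(\<Sum>l\<le>j. c l * A $$ (i, l)) \<noteq> 0"
  using assms unfolding pivots_def by auto

text \<open>
  A column that is not a pivot is a combination of columns to its left, so that an induction
  from left to right replaces all of them by pivot columns.
\<close>

lemma col_combination_of_pivots:
  fixes A :: "'a::field mat"
  assumes "j < dim_col A"
  shows "\<exists>a. \<forall>i<dim_row A. A $$ (i, j) = (\<Sum>p\<in>pivots A. a p * A $$ (i, p))"
  using assms
proof (induction j rule: less_induct)
  case (less j)
  show ?case
  proof (cases "j \<in> pivots A")
    case True
    have "A $$ (i, j) = (\<Sum>p\<in>pivots A. (if p = j then 1 else 0) * A $$ (i, p))" for i
    proof -
      have "(\<Sum>p\<in>pivots A. (if p = j then 1 else 0) * A $$ (i, p))
          = (\<Sum>p\<in>pivots A. if p = j then A $$ (i, p) else 0)"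
        by (rule sum.cong) auto
      then show ?thesis
        using True by (simp add: finite_pivots)
    qed
    then show ?thesis by (intro exI[of _ "\<lambda>p. if p = j then 1 else 0"] allI impI)
  next
    case False
    then obtain c where c: "c j \<noteq> 0" and z: "\<And>i. i < dim_row A \<Longrightarrow> (\<Sum>l\<le>j. c l * A $$ (i, l)) = 0"
      using less.prems unfolding pivots_def by blast
    have "\<forall>l. \<exists>a. l < j \<longrightarrow> (\<forall>i<dim_row A. A $$ (i, l) = (\<Sum>p\<in>pivots A. a p * A $$ (i, p)))"
      using less.IH less.prems by (meson order_less_trans)
    from choice[OF this] obtain a where
      a: "\<And>l i. l < j \<Longrightarrow> i < dim_row A \<Longrightarrow> A $$ (i, l) = (\<Sum>p\<in>pivots A. a l p * A $$ (i, p))"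
      by blast
    have "A $$ (i, j) = (\<Sum>p\<in>pivots A. (\<Sum>l<j. - (c l / c j) * a l p) * A $$ (i, p))"
      if i: "i < dim_row A" for i
    proof -
      have "(\<Sum>l<j. c l * A $$ (i, l)) + c j * A $$ (i, j) = 0"
        using z[OF i] by (simp flip: lessThan_Suc_atMost)
      then have "A $$ (i, j) = - (\<Sum>l<j. c l * A $$ (i, l)) / c j"
        using c by (subst nonzero_eq_divide_eq) (simp_all add: eq_neg_iff_add_eq_0 algebra_simps)
      also have "\<dots> = (\<Sum>l<j. - (c l / c j) * A $$ (i, l))"
        by (simp add: sum_divide_distrib sum_negf)
      also have "\<dots> = (\<Sum>l<j. \<Sum>p\<in>pivots A. - (c l / c j) * a l p * A $$ (i, p))"
      proof (rule sum.cong)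
        fix l assume "l \<in> {..<j}"
        then have "A $$ (i, l) = (\<Sum>p\<in>pivots A. a l p * A $$ (i, p))" using a i by simp
        then show "- (c l / c j) * A $$ (i, l) = (\<Sum>p\<in>pivots A. - (c l / c j) * a l p * A $$ (i, p))"
          by (simp only: sum_distrib_left mult.assoc)
      qed simp
      also have "\<dots> = (\<Sum>p\<in>pivots A. \<Sum>l<j. - (c l / c j) * a l p * A $$ (i, p))"
        by (rule sum.swap)
      finally show ?thesis by (simp add: sum_distrib_right)
    qed
    then show ?thesis by (intro exI[of _ "\<lambda>p. \<Sum>l<j. - (c l / c j) * a l p"] allI impI)
  qed
qed

lemma inj_on_col_pivots:
  fixes A :: "'a::field mat"
  shows "inj_on (col A) (pivots A)"
proof -
  have *: "False" if "j < k" "j \<in> pivots A" "k \<in> pivots A" and eq: "col A j = col A k" for j k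
  proof -
    let ?c = "\<lambda>l. (if l = k then 1 else 0) - (if l = j then 1 else 0 :: 'a)"
    have "?c k \<noteq> 0" using \<open>j < k\<close> by auto
    then obtain i where i: "i < dim_row A" and nz: "(\<Sum>l\<le>k. ?c l * A $$ (i, l)) \<noteq> 0"
      by (rule pivots_sum_nonzero[OF \<open>k \<in> pivots A\<close>, of ?c])
    have "(\<Sum>l\<le>k. ?c l * A $$ (i, l)) = A $$ (i, k) - A $$ (i, j)"
    proof -
      have "(\<Sum>l\<le>k. ?c l * A $$ (i, l))
          = (\<Sum>l\<le>k. (if l = k then A $$ (i, l) else 0) - (if l = j then A $$ (i, l) else 0))"
        by (rule sum.cong) auto
      then show ?thesis
        using \<open>j < k\<close> by (simp add: sum_subtractf)
    qed
    also have "\<dots> = 0"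
    proof -
      have "j < dim_col A" "k < dim_col A" using that unfolding pivots_def by auto
      then have "A $$ (i, j) = vec_index (col A j) i" "A $$ (i, k) = vec_index (col A k) i"
        using i by auto
      then show ?thesis using eq by simp
    qed
    finally show False using nz by contradiction
  qed
  show ?thesis
  proof (rule inj_onI)
    fix j k assume "j \<in> pivots A" "k \<in> pivots A" "col A j = col A k"
    then have "\<not> j < k" "\<not> k < j" using *[of j k] *[of k j] by auto
    then show "j = k" by simp
  qed
qed

text \<open>
  The pivot columns form a maximal independent set of columns: a vanishing combination has a
  last pivot with nonzero coefficient, which contradicts the definition of a pivot, and every
  other column depends on them.
\<close>

lemma (in vec_space) rank_eq_card_pivots:
  assumes A: "A \<in> carrier_mat n nc"
  shows "rank A = card (pivots A)"
proof -
  let ?P = "pivots A" and ?U = "col A ` pivots A"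
  have dims: "dim_row A = n" "dim_col A = nc" using A by auto
  have PA: "p < nc" if "p \<in> ?P" for p using that dims unfolding pivots_def by auto
  have cols: "set (cols A) = col A ` {..<nc}" using dims by (auto simp: cols_def)
  have carr: "col A ` J \<subseteq> carrier_vec n" for J using A by auto
  have Usub: "?U \<subseteq> set (cols A)" using PA cols by auto
  have reidx: "(\<Sum>x\<in>?U. a x * vec_index x i) = (\<Sum>p\<in>?P. a (col A p) * A $$ (i, p))" if "i < n" for a i
    using that dims PA by (simp add: sum.reindex[OF inj_on_col_pivots])
  have indpt: "lin_indpt ?U"
  proof
    assume "lin_dep ?U"
    then obtain a v where a: "lincomb a ?U = 0\<^sub>v n" and v: "v \<in> ?U" "a v \<noteq> 0"
      using finite_lin_dep[of ?U] carr[of ?P] finite_pivots[of A] by auto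
    define J where "J = Max {p \<in> ?P. a (col A p) \<noteq> 0}"
    have fin: "finite {p \<in> ?P. a (col A p) \<noteq> 0}" and ne: "{p \<in> ?P. a (col A p) \<noteq> 0} \<noteq> {}"
      using v by (auto intro: finite_subset[OF _ finite_pivots])
    have J: "J \<in> ?P" "a (col A J) \<noteq> 0" using Max_in[OF fin ne] unfolding J_def by auto
    have Jmax: "a (col A p) = 0" if "p \<in> ?P" "p > J" for p
      using Max_ge[OF fin, of p] that unfolding J_def by force
    \<comment> \<open>Cut off after column \<open>J\<close>, the combination has the form in the definition of \<open>pivots\<close>.\<close>
    define c where "c l = (if l \<in> ?P then a (col A l) else 0)" for l
    have "c J \<noteq> 0" using J by (simp add: c_def)
    then obtain i where i: "i < n" and nz: "(\<Sum>l\<le>J. c l * A $$ (i, l)) \<noteq> 0"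
      using pivots_sum_nonzero[OF J(1), of c] dims by auto
    have "(\<Sum>l\<le>J. c l * A $$ (i, l)) = (\<Sum>p\<in>?P. a (col A p) * A $$ (i, p))"
      by (rule sum.mono_neutral_cong) (auto simp: c_def finite_pivots Jmax not_le)
    also have "\<dots> = vec_index (lincomb a ?U) i"
      by (subst lincomb_index[OF i carr]) (simp add: reidx i)
    finally show False using nz a i by simp
  qed
  have "maximal ?U (\<lambda>T. T \<subseteq> set (cols A) \<and> lin_indpt T)"
    unfolding maximal_def
  proof (intro conjI allI impI)
    show "?U \<subseteq> set (cols A)" by (fact Usub)
    show "lin_indpt ?U" by (fact indpt)
    fix T assume T: "?U \<subseteq> T \<and> T \<subseteq> set (cols A) \<and> lin_indpt T"
    show "T = ?U"
    proof (rule ccontr)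
      assume "T \<noteq> ?U"
      then obtain x where x: "x \<in> T" "x \<notin> ?U" using T by blast
      then obtain j where j: "j < nc" "x = col A j" using T cols by auto
      obtain b where b: "\<And>i. i < n \<Longrightarrow> A $$ (i, j) = (\<Sum>p\<in>?P. b p * A $$ (i, p))"
        using col_combination_of_pivots[of j A] j dims by auto
      define a where "a y = (if y = x then - 1 else b (inv_into ?P (col A) y))" for y
      have ax: "a x = - 1" by (simp add: a_def)
      have ap: "a (col A p) = b p" if "p \<in> ?P" for p
        using that x(2) by (auto simp: a_def inv_into_f_f[OF inj_on_col_pivots])
      have sub: "insert x ?U \<subseteq> carrier_vec n" using carr j A by auto
      have "lincomb a (insert x ?U) = 0\<^sub>v n"
      proof (rule eq_vecI)
        show "dim_vec (lincomb a (insert x ?U)) = dim_vec (0\<^sub>v n)"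
          using lincomb_dim[OF _ sub] by (simp add: finite_pivots)
        fix i assume "i < dim_vec (0\<^sub>v n :: 'a vec)"
        then have i: "i < n" by simp
        have "vec_index (lincomb a (insert x ?U)) i = a x * vec_index x i + (\<Sum>y\<in>?U. a y * vec_index y i)"
          using x(2) by (simp add: lincomb_index[OF i sub] finite_pivots)
        also have "\<dots> = - (A $$ (i, j)) + (\<Sum>p\<in>?P. b p * A $$ (i, p))"
          using i j dims by (simp add: reidx ap ax[unfolded j(2)] cong: sum.cong)
        finally show "vec_index (lincomb a (insert x ?U)) i = vec_index (0\<^sub>v n) i" using b i by simp
      qed
      moreover have "finite (insert x ?U)" by (simp add: finite_pivots)
      moreover have "insert x ?U \<subseteq> T" using T x by blast
      moreover have "a x \<noteq> 0" by (simp add: ax)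
      ultimately have "lin_dep T"
        using lin_dep_crit[of "insert x ?U" T x a] by simp
      then show False using T by blast
    qed
  qed
  then have "rank A = card ?U" by (rule rank_card_indpt[OF A])
  then show ?thesis by (simp add: card_image inj_on_col_pivots)
qed

section \<open>Square integrable continuous functions\<close>

text \<open>
  The complement of the support is a union of open null sets. By the Lindelof property a
  countable subfamily has the same union.
\<close>

lemma AE_supp_measure:
  fixes \<mu> :: "'a::second_countable_topology measure"
  assumes "sets \<mu> = sets borel"
  shows "AE x in \<mu>. x \<in> supp_measure \<mu>"
proof -
  define F where "F = {U. open U \<and> emeasure \<mu> U = 0}"
  obtain F' where F': "F' \<subseteq> F" "countable F'" "\<Union>F' = \<Union>F"
    using Lindelof[of F] unfolding F_def by auto
  have "U \<in> null_sets \<mu>" if "U \<in> F'" for U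
    using that F'(1) assms unfolding F_def by (auto simp: null_sets_def)
  then have "\<Union>F' \<in> null_sets \<mu>"
    using F'(2) by (intro null_sets_UN'[of F' id, simplified]) auto
  moreover have "- supp_measure \<mu> = \<Union>F"
    unfolding supp_measure_def F_def by (auto simp: zero_less_iff_neq_zero)
  ultimately show ?thesis
    using F'(3) by (intro AE_I'[of "\<Union>F"]) auto
qed

lemma integrable_continuous_compact_borel:
  fixes f :: "'a::second_countable_topology \<Rightarrow> complex"
  assumes \<mu>: "compact_borel_measure \<mu>" and f: "continuous_on UNIV f"
  shows "integrable \<mu> f"
proof -
  have sets: "sets \<mu> = sets borel" and fin: "finite_measure \<mu>" and cpt: "compact (supp_measure \<mu>)"
    using \<mu> unfolding compact_borel_measure_def by auto
  have "compact (f ` supp_measure \<mu>)"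
    using f cpt by (intro compact_continuous_image) (auto intro: continuous_on_subset)
  then obtain B where "\<forall>x\<in>supp_measure \<mu>. norm (f x) \<le> B"
    by (auto dest!: compact_imp_bounded simp: bounded_iff)
  then have "AE x in \<mu>. norm (f x) \<le> B"
    using AE_supp_measure[OF sets] by auto
  moreover have "f \<in> borel_measurable \<mu>"
    using borel_measurable_continuous_onI[OF f] sets by (simp cong: measurable_cong_sets)
  ultimately show ?thesis
    using finite_measure.integrable_const_bound[OF fin] by blast
qed

lemma inner_L2_cnj: "inner_L2 \<mu> g f = cnj (inner_L2 \<mu> f g)"
  unfolding inner_L2_def by (subst Bochner_Integration.integral_cnj[symmetric]) (simp add: mult.commute)

lemma inner_L2_sum_left:
  fixes g :: "'a::second_countable_topology \<Rightarrow> complex"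
  assumes \<mu>: "compact_borel_measure \<mu>" and I: "finite I"
    and h: "\<And>i. i \<in> I \<Longrightarrow> continuous_on UNIV (h i)" and g: "continuous_on UNIV g"
  shows "inner_L2 \<mu> (\<lambda>z. \<Sum>i\<in>I. c i * h i z) g = (\<Sum>i\<in>I. c i * inner_L2 \<mu> (h i) g)"
proof -
  have int: "integrable \<mu> (\<lambda>z. c i * (h i z * cnj (g z)))" if "i \<in> I" for i
    using that h g by (intro integrable_continuous_compact_borel[OF \<mu>] continuous_intros)
  have "inner_L2 \<mu> (\<lambda>z. \<Sum>i\<in>I. c i * h i z) g = (\<integral>z. (\<Sum>i\<in>I. c i * (h i z * cnj (g z))) \<partial>\<mu>)"
    unfolding inner_L2_def by (simp add: sum_distrib_right mult.assoc)
  also have "\<dots> = (\<Sum>i\<in>I. \<integral>z. c i * (h i z * cnj (g z)) \<partial>\<mu>)"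
    using int by (intro Bochner_Integration.integral_sum)
  finally show ?thesis unfolding inner_L2_def by simp
qed

lemma inner_L2_diff_left:
  fixes g :: "'a::second_countable_topology \<Rightarrow> complex"
  assumes \<mu>: "compact_borel_measure \<mu>"
    and "continuous_on UNIV f" "continuous_on UNIV h" "continuous_on UNIV g"
  shows "inner_L2 \<mu> (\<lambda>z. f z - h z) g = inner_L2 \<mu> f g - inner_L2 \<mu> h g"
proof -
  have "integrable \<mu> (\<lambda>z. f z * cnj (g z))" "integrable \<mu> (\<lambda>z. h z * cnj (g z))"
    using assms by (auto intro!: integrable_continuous_compact_borel continuous_intros)
  then show ?thesis unfolding inner_L2_def by (simp add: left_diff_distrib)
qed

lemma inner_L2_self: "inner_L2 \<mu> f f = complex_of_real (\<integral>z. (cmod (f z))\<^sup>2 \<partial>\<mu>)"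
  unfolding inner_L2_def complex_norm_square[symmetric] by (rule integral_complex_of_real)

lemma norm_L2_sq: "(norm_L2 \<mu> f)\<^sup>2 = (\<integral>z. (cmod (f z))\<^sup>2 \<partial>\<mu>)"
  unfolding norm_L2_def inner_L2_self by simp

lemma inner_L2_self_norm: "inner_L2 \<mu> f f = of_real ((norm_L2 \<mu> f)\<^sup>2)"
  unfolding norm_L2_sq by (rule inner_L2_self)

text \<open>
  A seminorm zero function vanishes almost everywhere, hence is orthogonal to every
  function; this is what makes the kernel of a moment matrix the space of null polynomials.
\<close>

lemma norm_L2_eq_0_imp_inner_L2_eq_0:
  fixes f :: "'a::second_countable_topology \<Rightarrow> complex"
  assumes \<mu>: "compact_borel_measure \<mu>" and f: "continuous_on UNIV f" and z: "norm_L2 \<mu> f = 0"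
  shows "inner_L2 \<mu> f g = 0"
proof -
  have "integrable \<mu> (\<lambda>z. complex_of_real ((cmod (f z))\<^sup>2))"
    using f by (intro integrable_continuous_compact_borel[OF \<mu>] continuous_intros)
  then have "integrable \<mu> (\<lambda>z. (cmod (f z))\<^sup>2)"
    by (simp only: complex_of_real_integrable_eq)
  moreover have "(\<integral>z. (cmod (f z))\<^sup>2 \<partial>\<mu>) = 0" using z norm_L2_sq[of \<mu> f] by simp
  ultimately have "AE z in \<mu>. (cmod (f z))\<^sup>2 = 0"
    using integral_nonneg_eq_0_iff_AE[of \<mu> "\<lambda>z. (cmod (f z))\<^sup>2"] by simp
  then have "AE z in \<mu>. f z * cnj (g z) = 0" by auto
  then show ?thesis unfolding inner_L2_def by (rule integral_eq_zero_AE)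
qed

section \<open>Linear combinations and orthonormal families\<close>

definition lin_combs :: "('i \<Rightarrow> 'a \<Rightarrow> complex) \<Rightarrow> 'i set \<Rightarrow> ('a \<Rightarrow> complex) set" where
  "lin_combs h I = {\<lambda>z. \<Sum>i\<in>I. c i * h i z |c. True}"

lemma lin_combs_sum: "(\<lambda>z. \<Sum>i\<in>I. c i * h i z) \<in> lin_combs h I"
  unfolding lin_combs_def by blast

lemma lin_combs_trans:
  assumes "p \<in> lin_combs h I" and "\<And>i. i \<in> I \<Longrightarrow> h i \<in> lin_combs g J"
  shows "p \<in> lin_combs g J"
proof -
  obtain c where p: "p = (\<lambda>z. \<Sum>i\<in>I. c i * h i z)" using assms(1) unfolding lin_combs_def by blast
  have "\<forall>i. \<exists>a. i \<in> I \<longrightarrow> h i = (\<lambda>z. \<Sum>j\<in>J. a j * g j z)"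
    using assms(2) unfolding lin_combs_def by blast
  from choice[OF this] obtain a where a: "\<And>i. i \<in> I \<Longrightarrow> h i = (\<lambda>z. \<Sum>j\<in>J. a i j * g j z)"
    by blast
  have "p z = (\<Sum>j\<in>J. (\<Sum>i\<in>I. c i * a i j) * g j z)" for z
  proof -
    have "p z = (\<Sum>i\<in>I. \<Sum>j\<in>J. c i * a i j * g j z)"
      unfolding p by (rule sum.cong) (simp_all add: a sum_distrib_left mult.assoc)
    also have "\<dots> = (\<Sum>j\<in>J. \<Sum>i\<in>I. c i * a i j * g j z)" by (rule sum.swap)
    finally show ?thesis by (simp add: sum_distrib_right)
  qed
  then have "p = (\<lambda>z. \<Sum>j\<in>J. (\<Sum>i\<in>I. c i * a i j) * g j z)" by (rule ext)
  then show ?thesis by (simp only: lin_combs_sum)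
qed

lemma lin_combs_base:
  assumes "finite I" "i \<in> I" shows "h i \<in> lin_combs h I"
proof -
  have "h i = (\<lambda>z. \<Sum>j\<in>I. (if j = i then 1 else 0) * h j z)"
  proof
    fix z
    have "(\<Sum>j\<in>I. (if j = i then 1 else 0) * h j z) = (\<Sum>j\<in>I. if j = i then h j z else 0)"
      by (rule sum.cong) auto
    then show "h i z = (\<Sum>j\<in>I. (if j = i then 1 else 0) * h j z)"
      using assms by simp
  qed
  then show ?thesis using lin_combs_sum by metis
qed

lemma lin_combs_mono:
  assumes "I \<subseteq> J" "finite J" "p \<in> lin_combs h I" shows "p \<in> lin_combs h J"
  using assms by (intro lin_combs_trans[OF assms(3)]) (auto intro: lin_combs_base)

lemma lin_combs_scale:
  assumes "p \<in> lin_combs h I" shows "(\<lambda>z. a * p z) \<in> lin_combs h I"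
proof -
  obtain c where "p = (\<lambda>z. \<Sum>i\<in>I. c i * h i z)" using assms unfolding lin_combs_def by blast
  then have "(\<lambda>z. a * p z) = (\<lambda>z. \<Sum>i\<in>I. (a * c i) * h i z)" by (simp add: sum_distrib_left mult.assoc)
  then show ?thesis by (simp only: lin_combs_sum)
qed

lemma lin_combs_add:
  assumes "p \<in> lin_combs h I" "q \<in> lin_combs h I" shows "(\<lambda>z. p z + q z) \<in> lin_combs h I"
proof -
  obtain c d where "p = (\<lambda>z. \<Sum>i\<in>I. c i * h i z)" "q = (\<lambda>z. \<Sum>i\<in>I. d i * h i z)"
    using assms unfolding lin_combs_def by blast
  then have "(\<lambda>z. p z + q z) = (\<lambda>z. \<Sum>i\<in>I. (c i + d i) * h i z)"
    by (simp add: sum.distrib distrib_right)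
  then show ?thesis by (simp only: lin_combs_sum)
qed

lemma continuous_on_lin_combs:
  assumes "p \<in> lin_combs h I" "\<And>i. i \<in> I \<Longrightarrow> continuous_on S (h i)"
  shows "continuous_on S p"
  using assms unfolding lin_combs_def by (auto intro!: continuous_intros)

lemma continuous_on_monomial: "continuous_on S (monomial a)"
  unfolding monomial_def by (intro continuous_intros)

definition orthonormal_L2 :: "'a::topological_space measure \<Rightarrow> ('i \<Rightarrow> 'a \<Rightarrow> complex) \<Rightarrow> 'i set \<Rightarrow> bool" where
  "orthonormal_L2 \<mu> f I \<longleftrightarrow> (\<forall>i\<in>I. continuous_on UNIV (f i)) \<and>
     (\<forall>i\<in>I. \<forall>j\<in>I. inner_L2 \<mu> (f i) (f j) = (if i = j then 1 else 0))"

lemma norm_L2_orthonormal: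
  fixes f :: "'i \<Rightarrow> 'a::second_countable_topology \<Rightarrow> complex"
  assumes \<mu>: "compact_borel_measure \<mu>" and I: "finite I" and on: "orthonormal_L2 \<mu> f I"
  shows "(norm_L2 \<mu> (\<lambda>z. \<Sum>i\<in>I. c i * f i z))\<^sup>2 = (\<Sum>i\<in>I. (cmod (c i))\<^sup>2)"
proof -
  let ?p = "\<lambda>z. \<Sum>i\<in>I. c i * f i z"
  have cf: "continuous_on UNIV (f i)" if "i \<in> I" for i using that on unfolding orthonormal_L2_def by blast
  have cp: "continuous_on UNIV ?p" using cf by (intro continuous_intros) auto
  have coeff: "inner_L2 \<mu> ?p (f j) = c j" if "j \<in> I" for j
  proof -
    have "inner_L2 \<mu> ?p (f j) = (\<Sum>i\<in>I. c i * inner_L2 \<mu> (f i) (f j))"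
      using cf that by (intro inner_L2_sum_left[OF \<mu> I]) auto
    also have "\<dots> = (\<Sum>i\<in>I. if i = j then c i else 0)"
      using on that unfolding orthonormal_L2_def by (intro sum.cong) auto
    finally show ?thesis using that I by simp
  qed
  have "inner_L2 \<mu> ?p ?p = (\<Sum>i\<in>I. c i * inner_L2 \<mu> (f i) ?p)"
    using cf cp by (intro inner_L2_sum_left[OF \<mu> I]) auto
  also have "\<dots> = (\<Sum>i\<in>I. c i * cnj (c i))"
    by (intro sum.cong) (simp_all add: inner_L2_cnj[of \<mu> "f _" ?p] coeff)
  also have "\<dots> = of_real (\<Sum>i\<in>I. (cmod (c i))\<^sup>2)"
    by (simp only: of_real_sum complex_norm_square)
  finally show ?thesis unfolding inner_L2_self_norm of_real_eq_iff .
qed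

lemma norm_sum_mult_le:
  fixes u v :: "'i \<Rightarrow> complex"
  shows "cmod (\<Sum>i\<in>I. u i * v i) \<le> sqrt (\<Sum>i\<in>I. (cmod (u i))\<^sup>2) * sqrt (\<Sum>i\<in>I. (cmod (v i))\<^sup>2)"
proof -
  have "cmod (\<Sum>i\<in>I. u i * v i) \<le> (\<Sum>i\<in>I. \<bar>cmod (u i)\<bar> * \<bar>cmod (v i)\<bar>)"
    by (rule order_trans[OF norm_sum]) (simp add: norm_mult)
  also have "\<dots> \<le> sqrt (\<Sum>i\<in>I. (cmod (u i))\<^sup>2) * sqrt (\<Sum>i\<in>I. (cmod (v i))\<^sup>2)"
    using L2_set_mult_ineq[of "\<lambda>i. cmod (u i)" "\<lambda>i. cmod (v i)" I] unfolding L2_set_def .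
  finally show ?thesis .
qed

text \<open>
  For a linear functional \<open>\<Lambda>\<close> on the span of \<open>f\<close>, the sum \<open>\<Sum>\<^sub>j \<bar>\<Lambda> f\<^sub>j\<bar>\<^sup>2\<close> is the
  squared norm of \<open>\<Lambda>\<close> dual to the norm of \<open>L\<^sup>2(\<mu>)\<close>, and similarly for \<open>g\<close> and \<open>\<nu>\<close>. Dual norms
  compare in the direction opposite to the norms themselves; to see this, evaluate \<open>\<Lambda>\<close> at the
  function that represents it with respect to \<open>\<nu>\<close>, and estimate this value by the Cauchy--Schwarz
  inequality for \<open>\<mu>\<close>. The functionals \<open>\<Lambda> p = a p(z) + b p(w)\<close> are the ones of interest: with two
  points they also give access to the values of a kernel off the diagonal.
\<close>

lemma functional_norm_le:
  fixes f g :: "'i \<Rightarrow> 'a::second_countable_topology \<Rightarrow> complex"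
  assumes \<mu>: "compact_borel_measure \<mu>" and \<nu>: "compact_borel_measure \<nu>"
    and I: "finite I" and f: "orthonormal_L2 \<mu> f I" and g: "orthonormal_L2 \<nu> g I"
    and span: "\<And>j. j \<in> I \<Longrightarrow> g j \<in> lin_combs f I"
    and C: "0 \<le> C" and le: "\<And>p. p \<in> lin_combs g I \<Longrightarrow> (norm_L2 \<mu> p)\<^sup>2 \<le> C * (norm_L2 \<nu> p)\<^sup>2"
  shows "(\<Sum>j\<in>I. (cmod (a * g j z + b * g j w))\<^sup>2) \<le> C * (\<Sum>j\<in>I. (cmod (a * f j z + b * f j w))\<^sup>2)"
proof -
  define G where "G j = a * g j z + b * g j w" for j
  define F where "F j = a * f j z + b * f j w" for j
  \<comment> \<open>The Riesz representer of the functional with respect to \<open>\<nu>\<close>.\<close>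
  define p where "p = (\<lambda>x. \<Sum>j\<in>I. cnj (G j) * g j x)"
  define N where "N = (\<Sum>j\<in>I. (cmod (G j))\<^sup>2)"
  have pg: "p \<in> lin_combs g I" unfolding p_def by (rule lin_combs_sum)
  then have "p \<in> lin_combs f I" using span by (auto intro: lin_combs_trans)
  then obtain c where c: "p = (\<lambda>x. \<Sum>j\<in>I. c j * f j x)" unfolding lin_combs_def by blast
  have N\<nu>: "(norm_L2 \<nu> p)\<^sup>2 = N"
    unfolding p_def norm_L2_orthonormal[OF \<nu> I g] N_def by simp
  have N\<mu>: "(norm_L2 \<mu> p)\<^sup>2 = (\<Sum>j\<in>I. (cmod (c j))\<^sup>2)"
    unfolding c norm_L2_orthonormal[OF \<mu> I f] ..
  have G: "a * (x * g j z) + b * (x * g j w) = G j * x"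
    and F: "a * (x * f j z) + b * (x * f j w) = x * F j" for j x
    unfolding G_def F_def by (simp_all add: distrib_left distrib_right ac_simps)
  have "a * p z + b * p w = (\<Sum>j\<in>I. G j * cnj (G j))"
    unfolding p_def by (simp only: sum_distrib_left sum.distrib[symmetric] G)
  then have val: "a * p z + b * p w = of_real N"
    unfolding N_def by (simp only: of_real_sum complex_norm_square)
  have "a * p z + b * p w = (\<Sum>j\<in>I. c j * F j)"
    unfolding c by (simp only: sum_distrib_left sum.distrib[symmetric] F)
  then have "cmod (of_real N) \<le> norm_L2 \<mu> p * sqrt (\<Sum>j\<in>I. (cmod (F j))\<^sup>2)"
    using norm_sum_mult_le[of c F "I"] unfolding val N\<mu>[symmetric] 
    by (simp add: norm_L2_def inner_L2_self)
  moreover have N0: "N \<ge> 0" unfolding N_def by (simp add: sum_nonneg)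
  ultimately have "N\<^sup>2 \<le> (norm_L2 \<mu> p * sqrt (\<Sum>j\<in>I. (cmod (F j))\<^sup>2))\<^sup>2"
    by (intro power_mono) auto
  also have "\<dots> = (norm_L2 \<mu> p)\<^sup>2 * (\<Sum>j\<in>I. (cmod (F j))\<^sup>2)"
    by (simp add: power_mult_distrib sum_nonneg)
  also have "\<dots> \<le> (C * N) * (\<Sum>j\<in>I. (cmod (F j))\<^sup>2)"
    using le[OF pg] N\<nu> by (intro mult_right_mono) (auto intro: sum_nonneg)
  finally have *: "N * N \<le> N * (C * (\<Sum>j\<in>I. (cmod (F j))\<^sup>2))"
    by (simp add: power2_eq_square ac_simps)
  show ?thesis
  proof (cases "N = 0")
    case True
    then show ?thesis using C unfolding N_def G_def by (simp add: sum_nonneg)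
  next
    case False
    then show ?thesis using * N0 unfolding N_def G_def F_def by simp
  qed
qed

section \<open>Ranks of moment matrices\<close>

lemma mono_card_Int_atMost: "k \<le> l \<Longrightarrow> card (S \<inter> {..k}) \<le> card (S \<inter> {..l::nat})"
  by (intro card_mono) auto

lemma card_Int_atMost_Suc:
  "card (S \<inter> {..Suc k}) = card (S \<inter> {..k}) + (if Suc k \<in> S then 1 else 0)"
proof -
  have "S \<inter> {..Suc k} = (if Suc k \<in> S then insert (Suc k) (S \<inter> {..k}) else S \<inter> {..k})"
    by (auto simp: le_Suc_eq)
  then show ?thesis by simp
qed

lemma card_Int_atMost_attains:
  assumes "0 < j" and "j \<le> card (S \<inter> {..k::nat})"
  shows "\<exists>l. card (S \<inter> {..l}) = j"
  using assms(2)
proof (induction k)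
  case 0
  moreover have "card (S \<inter> {..0}) \<le> 1" using card_mono[of "{0::nat}" "S \<inter> {..0}"] by auto
  ultimately show ?case using \<open>0 < j\<close> by (intro exI[of _ 0]) linarith
next
  case (Suc k)
  show ?case
  proof (cases "j \<le> card (S \<inter> {..k})")
    case True
    then show ?thesis by (rule Suc.IH)
  next
    case False
    then have "card (S \<inter> {..Suc k}) = j"
      using Suc.prems by (auto simp: card_Int_atMost_Suc split: if_splits)
    then show ?thesis by blast
  qed
qed

text \<open>
  The least \<open>k\<close> with \<open>card (S \<inter> {..k}) = j + 1\<close> is the element number \<open>j\<close> of \<open>S\<close>, counted
  from 0. The function \<open>k \<mapsto> card (S \<inter> {..k})\<close> grows in steps of at most 1, so if it reaches
  \<open>n + 1\<close>, then it takes all smaller positive values too.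
\<close>

lemma Least_card_Int_atMost:
  fixes S :: "nat set" and n :: nat
  defines "D \<equiv> \<lambda>j. LEAST k. card (S \<inter> {..k}) = j + 1"
  assumes ex: "\<exists>k. card (S \<inter> {..k}) = n + 1" and "j \<le> n"
  shows "card (S \<inter> {..D j}) = j + 1" and "D j \<in> S" and "i < j \<Longrightarrow> D i < D j"
proof -
  have card_D: "card (S \<inter> {..D i}) = i + 1" if "i \<le> n" for i
  proof -
    obtain k where "card (S \<inter> {..k}) = n + 1" using ex by blast
    then have "i + 1 \<le> card (S \<inter> {..k})" using that by simp
    then have "\<exists>k. card (S \<inter> {..k}) = i + 1" by (intro card_Int_atMost_attains) auto
    then show ?thesis unfolding D_def by (rule LeastI_ex)
  qed
  then show *: "card (S \<inter> {..D j}) = j + 1" using \<open>j \<le> n\<close> by simp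
  show "D j \<in> S"
  proof (rule ccontr)
    assume notin: "D j \<notin> S"
    show False
    proof (cases "D j")
      case 0
      then have "S \<inter> {..D j} = {}" using notin by auto
      then show False using * by simp
    next
      case (Suc m)
      then have "card (S \<inter> {..m}) = j + 1" using * notin by (simp add: card_Int_atMost_Suc)
      then have "D j \<le> m" unfolding D_def by (rule Least_le)
      then show False using Suc by simp
    qed
  qed
  show "D i < D j" if "i < j"
  proof (rule ccontr)
    assume "\<not> D i < D j"
    then have "card (S \<inter> {..D j}) \<le> card (S \<inter> {..D i})" by (intro mono_card_Int_atMost) simp
    then show False using card_D[of i] * \<open>j \<le> n\<close> that by simp
  qed
qed

text \<open>
  The degrees at which the monomial is not a combination of monomials of smaller degree in
  \<open>L\<^sup>2(\<mu>)\<close>.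
\<close>

definition new_degrees ::
    "(nat \<Rightarrow> nat ^ 'd) \<Rightarrow> (complex ^ 'd) measure \<Rightarrow> nat set" where
  "new_degrees \<alpha> \<mu> = {k. \<forall>p. has_degree \<alpha> p k \<longrightarrow> norm_L2 \<mu> p \<noteq> 0}"

text \<open>
  The squared norm of a polynomial is a combination of its inner products with the monomials
  occurring in it.
\<close>

lemma norm_L2_eq_0_iff_orthogonal_to_monomials:
  fixes \<mu> :: "(complex ^ 'd) measure" and \<alpha> :: "nat \<Rightarrow> nat ^ 'd" and c :: "nat \<Rightarrow> complex"
  assumes \<mu>: "compact_borel_measure \<mu>" and "j \<le> k"
  defines "p \<equiv> \<lambda>z. \<Sum>l\<le>j. c l * monomial (\<alpha> l) z"
  shows "norm_L2 \<mu> p = 0 \<longleftrightarrow> (\<forall>i\<le>k. inner_L2 \<mu> p (monomial (\<alpha> i)) = 0)"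
proof
  have cont: "continuous_on UNIV p"
    unfolding p_def by (intro continuous_intros continuous_on_monomial)
  show "\<forall>i\<le>k. inner_L2 \<mu> p (monomial (\<alpha> i)) = 0" if "norm_L2 \<mu> p = 0"
    using norm_L2_eq_0_imp_inner_L2_eq_0[OF \<mu> cont that] by simp
  assume orth: "\<forall>i\<le>k. inner_L2 \<mu> p (monomial (\<alpha> i)) = 0"
  have "inner_L2 \<mu> p p = (\<Sum>l\<le>j. c l * inner_L2 \<mu> (monomial (\<alpha> l)) p)"
    by (subst (1) p_def) (intro inner_L2_sum_left[OF \<mu>] cont continuous_on_monomial; simp)
  also have "\<dots> = 0"
  proof (intro sum.neutral ballI)
    fix l assume "l \<in> {..j}"
    then have "inner_L2 \<mu> p (monomial (\<alpha> l)) = 0" using orth \<open>j \<le> k\<close> by simp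
    then show "c l * inner_L2 \<mu> (monomial (\<alpha> l)) p = 0"
      using inner_L2_cnj[of \<mu> "monomial (\<alpha> l)" p] by simp
  qed
  finally have "complex_of_real ((norm_L2 \<mu> p)\<^sup>2) = 0" by (simp only: inner_L2_self_norm)
  then show "norm_L2 \<mu> p = 0" by (simp only: of_real_eq_0_iff zero_eq_power2)
qed

text \<open>
  The moment matrix applied to the coefficient vector of a polynomial \<open>p\<close> gives the inner
  products of \<open>p\<close> with the monomials, so vanishing combinations of columns are null polynomials.
\<close>

lemma pivots_moment_matrix:
  fixes \<mu> :: "(complex ^ 'd) measure"
  assumes \<mu>: "compact_borel_measure \<mu>"
  shows "pivots (moment_matrix \<alpha> \<mu> k) = new_degrees \<alpha> \<mu> \<inter> {..k}"
proof -
  let ?M = "moment_matrix \<alpha> \<mu> k"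
  have dims: "dim_row ?M = k + 1" "dim_col ?M = k + 1" by (simp_all add: moment_matrix_def)
  have "j \<in> pivots ?M \<longleftrightarrow> j \<in> new_degrees \<alpha> \<mu>" if "j \<le> k" for j
  proof -
    have entry: "(\<Sum>l\<le>j. c l * ?M $$ (i, l))
        = inner_L2 \<mu> (\<lambda>z. \<Sum>l\<le>j. c l * monomial (\<alpha> l) z) (monomial (\<alpha> i))" if i: "i \<le> k" for c i
    proof -
      have "(\<Sum>l\<le>j. c l * ?M $$ (i, l)) = (\<Sum>l\<le>j. c l * inner_L2 \<mu> (monomial (\<alpha> l)) (monomial (\<alpha> i)))"
        using i \<open>j \<le> k\<close> by (intro sum.cong) (auto simp: moment_matrix_def inner_L2_def mult.commute)
      also have "\<dots> = inner_L2 \<mu> (\<lambda>z. \<Sum>l\<le>j. c l * monomial (\<alpha> l) z) (monomial (\<alpha> i))"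
        by (rule inner_L2_sum_left[OF \<mu>, symmetric]) (simp_all add: continuous_on_monomial)
      finally show ?thesis .
    qed
    have "(\<exists>i<dim_row ?M. (\<Sum>l\<le>j. c l * ?M $$ (i, l)) \<noteq> 0)
        \<longleftrightarrow> norm_L2 \<mu> (\<lambda>z. \<Sum>l\<le>j. c l * monomial (\<alpha> l) z) \<noteq> 0" for c
      using norm_L2_eq_0_iff_orthogonal_to_monomials[OF \<mu> that, where c = c and \<alpha> = \<alpha>]
      by (auto simp: dims less_Suc_eq_le entry)
    then show ?thesis
      using that by (auto simp: pivots_def new_degrees_def has_degree_def dims)
  qed
  moreover have "j \<le> k" if "j \<in> pivots ?M" for j using that by (simp add: pivots_def dims)
  ultimately show ?thesis by auto
qed

text \<open>
  Counting new degrees replaces the ranks from here on: the numbers \<open>index \<alpha> \<mu> j\<close> enumerate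
  \<open>new_degrees \<alpha> \<mu>\<close> in increasing order.
\<close>

lemma moment_rank_eq:
  fixes \<mu> :: "(complex ^ 'd) measure"
  assumes "compact_borel_measure \<mu>"
  shows "moment_rank \<alpha> \<mu> k = card (new_degrees \<alpha> \<mu> \<inter> {..k})"
proof -
  have "moment_matrix \<alpha> \<mu> k \<in> carrier_mat (k + 1) (k + 1)" by (simp add: moment_matrix_def)
  from vec_space.rank_eq_card_pivots[OF this] show ?thesis
    by (simp add: moment_rank_def pivots_moment_matrix[OF assms])
qed

context
  fixes \<alpha> :: "nat \<Rightarrow> nat ^ 'd" and \<mu> :: "(complex ^ 'd) measure" and n :: nat
  assumes \<mu>: "compact_borel_measure \<mu>" and def: "index_defined \<alpha> \<mu> n"
begin

lemma index_in_new_degrees: "j \<le> n \<Longrightarrow> index \<alpha> \<mu> j \<in> new_degrees \<alpha> \<mu>"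
  using Least_card_Int_atMost(2)[of "new_degrees \<alpha> \<mu>" n j] def
  unfolding index_def index_defined_def moment_rank_eq[OF \<mu>] by blast

lemma index_strict_mono: "i < j \<Longrightarrow> j \<le> n \<Longrightarrow> index \<alpha> \<mu> i < index \<alpha> \<mu> j"
  using Least_card_Int_atMost(3)[of "new_degrees \<alpha> \<mu>" n j i] def
  unfolding index_def index_defined_def moment_rank_eq[OF \<mu>] by blast

lemma index_mono: "j \<le> n \<Longrightarrow> index \<alpha> \<mu> j \<le> index \<alpha> \<mu> n"
  using index_strict_mono[of j n] by (cases "j = n") auto

lemma moment_rank_index: "j \<le> n \<Longrightarrow> moment_rank \<alpha> \<mu> (index \<alpha> \<mu> j) = j + 1"
  using Least_card_Int_atMost(1)[of "new_degrees \<alpha> \<mu>" n j] def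
  unfolding index_def index_defined_def moment_rank_eq[OF \<mu>] by blast

text \<open>
  As \<open>index\<close> is a least argument, it depends only on the ranks up to its value.
\<close>

lemma index_eq:
  assumes \<nu>: "compact_borel_measure \<nu>"
    and eq: "new_degrees \<alpha> \<mu> \<inter> {..index \<alpha> \<mu> n} = new_degrees \<alpha> \<nu> \<inter> {..index \<alpha> \<mu> n}"
    and "j \<le> n"
  shows "index \<alpha> \<nu> j = index \<alpha> \<mu> j"
proof -
  have rank: "moment_rank \<alpha> \<nu> k = moment_rank \<alpha> \<mu> k" if "k \<le> index \<alpha> \<mu> n" for k
  proof -
    have "new_degrees \<alpha> \<nu> \<inter> {..k} = (new_degrees \<alpha> \<nu> \<inter> {..index \<alpha> \<mu> n}) \<inter> {..k}"
      using that by auto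
    also have "\<dots> = (new_degrees \<alpha> \<mu> \<inter> {..index \<alpha> \<mu> n}) \<inter> {..k}"
      by (simp only: eq)
    also have "\<dots> = new_degrees \<alpha> \<mu> \<inter> {..k}"
      using that by auto
    finally have "new_degrees \<alpha> \<nu> \<inter> {..k} = new_degrees \<alpha> \<mu> \<inter> {..k}" .
    then show ?thesis by (simp add: moment_rank_eq \<mu> \<nu>)
  qed
  note le = index_mono[OF \<open>j \<le> n\<close>]
  show ?thesis
    unfolding index_def[of \<alpha> \<nu>]
  proof (rule Least_equality)
    show "moment_rank \<alpha> \<nu> (index \<alpha> \<mu> j) = j + 1"
      using rank[OF le] moment_rank_index[OF \<open>j \<le> n\<close>] by simp
    fix k assume k: "moment_rank \<alpha> \<nu> k = j + 1"
    show "index \<alpha> \<mu> j \<le> k"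
    proof (rule ccontr)
      assume less: "\<not> index \<alpha> \<mu> j \<le> k"
      then have "moment_rank \<alpha> \<mu> k = j + 1" using k rank[of k] le by simp
      then have "index \<alpha> \<mu> j \<le> k" unfolding index_def by (rule Least_le)
      then show False using less by simp
    qed
  qed
qed

end

section \<open>Gram--Schmidt orthonormalisation of the monomials\<close>

abbreviation index_monomial ::
    "(nat \<Rightarrow> nat ^ 'd) \<Rightarrow> (complex ^ 'd) measure \<Rightarrow> nat \<Rightarrow> complex ^ 'd \<Rightarrow> complex" where
  "index_monomial \<alpha> \<mu> n \<equiv> monomial (\<alpha> (index \<alpha> \<mu> n))"

definition projection ::
    "(nat \<Rightarrow> nat ^ 'd) \<Rightarrow> (complex ^ 'd) measure \<Rightarrow> nat \<Rightarrow> complex ^ 'd \<Rightarrow> complex" where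
  "projection \<alpha> \<mu> n = (\<lambda>z. \<Sum>j<n. inner_L2 \<mu> (index_monomial \<alpha> \<mu> n) (orthopoly \<alpha> \<mu> j) * orthopoly \<alpha> \<mu> j z)"

definition residual ::
    "(nat \<Rightarrow> nat ^ 'd) \<Rightarrow> (complex ^ 'd) measure \<Rightarrow> nat \<Rightarrow> complex ^ 'd \<Rightarrow> complex" where
  "residual \<alpha> \<mu> n = (\<lambda>z. index_monomial \<alpha> \<mu> n z - projection \<alpha> \<mu> n z)"

lemma orthopoly_eq:
  "orthopoly \<alpha> \<mu> n = (\<lambda>z. residual \<alpha> \<mu> n z / of_real (norm_L2 \<mu> (residual \<alpha> \<mu> n)))"
  unfolding residual_def projection_def by (subst orthopoly.simps) (simp add: Let_def)

lemma projection_in_orthopoly: "projection \<alpha> \<mu> n \<in> lin_combs (orthopoly \<alpha> \<mu>) {..<n}"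
  unfolding projection_def by (rule lin_combs_sum)

lemma orthopoly_in_index_monomials: "orthopoly \<alpha> \<mu> n \<in> lin_combs (index_monomial \<alpha> \<mu>) {..n}"
proof (induction n rule: less_induct)
  case (less n)
  have "projection \<alpha> \<mu> n \<in> lin_combs (index_monomial \<alpha> \<mu>) {..n}"
  proof (rule lin_combs_trans[OF projection_in_orthopoly])
    fix j assume j: "j \<in> {..<n}"
    then show "orthopoly \<alpha> \<mu> j \<in> lin_combs (index_monomial \<alpha> \<mu>) {..n}"
      by (intro lin_combs_mono[OF _ _ less.IH]) auto
  qed
  from lin_combs_add[OF lin_combs_base lin_combs_scale[OF this, of "-1"], of n]
  have "residual \<alpha> \<mu> n \<in> lin_combs (index_monomial \<alpha> \<mu>) {..n}"
    by (simp add: residual_def)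
  from lin_combs_scale[OF this, of "1 / of_real (norm_L2 \<mu> (residual \<alpha> \<mu> n))"]
  show ?case by (simp add: orthopoly_eq[of \<alpha> \<mu> n])
qed

lemma projection_in_index_monomials: "projection \<alpha> \<mu> n \<in> lin_combs (index_monomial \<alpha> \<mu>) {..<n}"
proof (rule lin_combs_trans[OF projection_in_orthopoly])
  fix j assume "j \<in> {..<n}"
  then show "orthopoly \<alpha> \<mu> j \<in> lin_combs (index_monomial \<alpha> \<mu>) {..<n}"
    by (intro lin_combs_mono[OF _ _ orthopoly_in_index_monomials]) auto
qed

lemma continuous_on_orthopoly: "continuous_on S (orthopoly \<alpha> \<mu> n)"
  by (rule continuous_on_lin_combs[OF orthopoly_in_index_monomials continuous_on_monomial])

lemma continuous_on_projection: "continuous_on S (projection \<alpha> \<mu> n)"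
  by (rule continuous_on_lin_combs[OF projection_in_orthopoly continuous_on_orthopoly])

lemma has_degree_residual:
  assumes "\<And>j. j < n \<Longrightarrow> index \<alpha> \<mu> j < index \<alpha> \<mu> n"
  shows "has_degree \<alpha> (residual \<alpha> \<mu> n) (index \<alpha> \<mu> n)"
proof -
  let ?K = "index \<alpha> \<mu> n"
  have "projection \<alpha> \<mu> n \<in> lin_combs (\<lambda>l. monomial (\<alpha> l)) {..<?K}"
    by (rule lin_combs_trans[OF projection_in_index_monomials])
       (use assms in \<open>auto intro: lin_combs_base[of _ _ "\<lambda>l. monomial (\<alpha> l)"]\<close>)
  then obtain c where c: "projection \<alpha> \<mu> n = (\<lambda>z. \<Sum>l<?K. c l * monomial (\<alpha> l) z)"
    unfolding lin_combs_def by blast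
  define e where "e l = (if l = ?K then 1 else - c l)" for l
  have "residual \<alpha> \<mu> n = (\<lambda>z. \<Sum>l\<le>?K. e l * monomial (\<alpha> l) z)"
  proof
    fix z
    have "(\<Sum>l<?K. e l * monomial (\<alpha> l) z) = (\<Sum>l<?K. - (c l * monomial (\<alpha> l) z))"
      by (rule sum.cong) (auto simp: e_def)
    then show "residual \<alpha> \<mu> n z = (\<Sum>l\<le>?K. e l * monomial (\<alpha> l) z)"
      by (simp add: residual_def c sum_negf e_def[of ?K] flip: lessThan_Suc_atMost)
  qed
  moreover have "e ?K \<noteq> 0" by (simp add: e_def)
  ultimately show ?thesis unfolding has_degree_def by blast
qed

text \<open>
  The projection has the same inner products with the earlier orthonormal polynomials as the
  monomial itself.
\<close>

lemma inner_L2_residual: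
  assumes \<mu>: "compact_borel_measure \<mu>" and on: "orthonormal_L2 \<mu> (orthopoly \<alpha> \<mu>) {..<n}" and "i < n"
  shows "inner_L2 \<mu> (residual \<alpha> \<mu> n) (orthopoly \<alpha> \<mu> i) = 0"
proof -
  let ?E = "index_monomial \<alpha> \<mu> n" and ?p = "orthopoly \<alpha> \<mu>"
  have "inner_L2 \<mu> (projection \<alpha> \<mu> n) (?p i) = (\<Sum>j<n. inner_L2 \<mu> ?E (?p j) * inner_L2 \<mu> (?p j) (?p i))"
    unfolding projection_def by (intro inner_L2_sum_left[OF \<mu>] continuous_on_orthopoly) auto
  also have "\<dots> = (\<Sum>j<n. if j = i then inner_L2 \<mu> ?E (?p j) else 0)"
    using on \<open>i < n\<close> unfolding orthonormal_L2_def by (intro sum.cong) auto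
  finally have "inner_L2 \<mu> (projection \<alpha> \<mu> n) (?p i) = inner_L2 \<mu> ?E (?p i)"
    using \<open>i < n\<close> by simp
  then show ?thesis
    unfolding residual_def
    by (simp add: inner_L2_diff_left[OF \<mu>] continuous_on_monomial continuous_on_projection continuous_on_orthopoly)
qed

lemma orthonormal_orthopoly:
  assumes \<mu>: "compact_borel_measure \<mu>" and nz: "\<And>j. j < n \<Longrightarrow> norm_L2 \<mu> (residual \<alpha> \<mu> j) \<noteq> 0"
  shows "orthonormal_L2 \<mu> (orthopoly \<alpha> \<mu>) {..<n}"
  using nz
proof (induction n)
  case 0
  show ?case by (simp add: orthonormal_L2_def)
next
  case (Suc n)
  let ?p = "orthopoly \<alpha> \<mu>" and ?q = "residual \<alpha> \<mu> n"
  let ?r = "norm_L2 \<mu> ?q"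
  have IH: "orthonormal_L2 \<mu> ?p {..<n}" using Suc by simp
  have r: "?r \<noteq> 0" using Suc.prems by simp
  have inner: "inner_L2 \<mu> (?p n) g = inner_L2 \<mu> ?q g / of_real ?r" for g
    unfolding orthopoly_eq[of \<alpha> \<mu> n] inner_L2_def by simp
  have "inner_L2 \<mu> (?p n) (?p n) = cnj (inner_L2 \<mu> ?q ?q) / of_real ?r / of_real ?r"
    unfolding inner[of "?p n"] inner_L2_cnj[of \<mu> ?q "?p n"] inner by simp
  also have "\<dots> = 1" using r by (simp add: inner_L2_self_norm power2_eq_square)
  finally have self: "inner_L2 \<mu> (?p n) (?p n) = 1" .
  have orth: "inner_L2 \<mu> (?p n) (?p i) = 0" if "i < n" for i
    using inner_L2_residual[OF \<mu> IH that] by (simp add: inner)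
  then have orth': "inner_L2 \<mu> (?p i) (?p n) = 0" if "i < n" for i
    using that inner_L2_cnj[of \<mu> "?p i" "?p n"] by simp
  show ?case
    using IH self orth orth' unfolding orthonormal_L2_def
    by (auto simp: less_Suc_eq continuous_on_orthopoly)
qed

text \<open>
  Solving the Gram--Schmidt recursion for the monomial shows that both families have the same
  span.
\<close>

lemma index_monomial_in_orthopoly:
  assumes "norm_L2 \<mu> (residual \<alpha> \<mu> n) \<noteq> 0"
  shows "index_monomial \<alpha> \<mu> n \<in> lin_combs (orthopoly \<alpha> \<mu>) {..n}"
proof -
  have "index_monomial \<alpha> \<mu> n
      = (\<lambda>z. of_real (norm_L2 \<mu> (residual \<alpha> \<mu> n)) * orthopoly \<alpha> \<mu> n z + projection \<alpha> \<mu> n z)"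
    using assms by (subst orthopoly_eq) (simp add: residual_def)
  moreover have "projection \<alpha> \<mu> n \<in> lin_combs (orthopoly \<alpha> \<mu>) {..n}"
    by (rule lin_combs_mono[OF _ _ projection_in_orthopoly]) auto
  ultimately show ?thesis
    by (simp only:) (intro lin_combs_add lin_combs_scale lin_combs_base; simp)
qed

text \<open>
  Subtracting lower terms keeps the leading monomial, whose degree is new, so Gram--Schmidt
  never divides by zero.
\<close>

lemma norm_residual_nonzero:
  assumes "compact_borel_measure \<mu>" and "index_defined \<alpha> \<mu> n" and "j \<le> n"
  shows "norm_L2 \<mu> (residual \<alpha> \<mu> j) \<noteq> 0"
proof -
  have "has_degree \<alpha> (residual \<alpha> \<mu> j) (index \<alpha> \<mu> j)"
    using assms by (intro has_degree_residual index_strict_mono[OF assms(1,2)]) auto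
  then show ?thesis
    using index_in_new_degrees[OF assms(1-3)] unfolding new_degrees_def by blast
qed

section \<open>Comparison of the kernels\<close>

text \<open>
  The squared dual norm of \<open>p \<mapsto> a p(z) + b p(w)\<close> is the Hermitian form with the kernel matrix
  at the points \<open>z\<close>, \<open>w\<close>.
\<close>

lemma sum_norm_sq_eq_CD:
  "(\<Sum>j\<le>n. (cmod (a * orthopoly \<alpha> \<mu> j z + b * orthopoly \<alpha> \<mu> j w))\<^sup>2)
   = (cmod a)\<^sup>2 * CD_diag \<alpha> \<mu> n z + (cmod b)\<^sup>2 * CD_diag \<alpha> \<mu> n w
     + 2 * Re (a * cnj b * CD_kernel \<alpha> \<mu> n z w)"
proof -
  have *: "(cmod (x + y))\<^sup>2 = (cmod x)\<^sup>2 + (cmod y)\<^sup>2 + 2 * Re (x * cnj y)" for x y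
    unfolding cmod_power2 by (simp add: power2_eq_square algebra_simps)
  have diag: "CD_diag \<alpha> \<mu> n u = (\<Sum>j\<le>n. (cmod (orthopoly \<alpha> \<mu> j u))\<^sup>2)" for u
    unfolding CD_diag_def CD_kernel_def by (simp add: complex_norm_square[symmetric] cmod_power2 power2_eq_square)
  have "Re (a * cnj b * CD_kernel \<alpha> \<mu> n z w)
      = (\<Sum>j\<le>n. Re (a * orthopoly \<alpha> \<mu> j z * cnj (b * orthopoly \<alpha> \<mu> j w)))"
    unfolding CD_kernel_def by (simp add: sum_distrib_left ac_simps del: times_complex.sel)
  then show ?thesis
    unfolding * diag by (simp add: sum.distrib sum_distrib_left norm_mult power_mult_distrib)
qed

lemma CD_diag_nonneg: "0 \<le> CD_diag \<alpha> \<mu> n z"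
proof -
  have "CD_diag \<alpha> \<mu> n z = (\<Sum>j\<le>n. (cmod (1 * orthopoly \<alpha> \<mu> j z + 0 * orthopoly \<alpha> \<mu> j z))\<^sup>2)"
    unfolding sum_norm_sq_eq_CD by simp
  then show ?thesis by (simp add: sum_nonneg)
qed

lemma cmod_CD_kernel_le: "cmod (CD_kernel \<alpha> \<mu> n z w) \<le> sqrt (CD_diag \<alpha> \<mu> n z) * sqrt (CD_diag \<alpha> \<mu> n w)"
proof -
  have "CD_diag \<alpha> \<mu> n u = (\<Sum>j\<le>n. (cmod (orthopoly \<alpha> \<mu> j u))\<^sup>2)" for u
    using sum_norm_sq_eq_CD[of 1 \<alpha> \<mu> u 0 u n] by simp
  then show ?thesis
    using norm_sum_mult_le[of "\<lambda>j. orthopoly \<alpha> \<mu> j z" "\<lambda>j. cnj (orthopoly \<alpha> \<mu> j w)" "{..n}"]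
    unfolding CD_kernel_def by simp
qed

text \<open>
  If the difference of two Hermitian forms on \<open>\<complex>\<^sup>2\<close> is at most \<open>\<epsilon>\<close> times the second form, then
  this bound passes to the off-diagonal entries: polarisation expresses the entry of the
  difference by the values of that form at \<open>(a, b)\<close> and \<open>(a, -b)\<close>, and in the sum of the two
  bounds the off-diagonal terms of the second form cancel. The moduli of \<open>a\<close> and \<open>b\<close> balance
  the two diagonal terms, and the phase of \<open>a\<close> makes the entry real.
\<close>

lemma hermitian_perturbation_le:
  fixes K L :: complex
  assumes form: "\<And>a b. \<bar>((cmod a)\<^sup>2 * x + (cmod b)\<^sup>2 * y + 2 * Re (a * cnj b * K))
                      - ((cmod a)\<^sup>2 * X + (cmod b)\<^sup>2 * Y + 2 * Re (a * cnj b * L))\<bar>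
             \<le> \<epsilon> * ((cmod a)\<^sup>2 * X + (cmod b)\<^sup>2 * Y + 2 * Re (a * cnj b * L))"
    and pos: "0 < X" "0 < Y"
  shows "cmod (K - L) \<le> \<epsilon> * sqrt X * sqrt Y"
proof -
  define s where "s = sqrt X * sqrt Y"
  have s: "0 < s" "X * Y = s * s" using pos by (auto simp: s_def simp flip: real_sqrt_mult)
  define a where "a = cnj (sgn (K - L)) * of_real (sqrt Y)"
  define b where "b = complex_of_real (sqrt X)"
  show ?thesis
  proof (cases "K = L")
    case True
    have "0 \<le> \<epsilon> * X" using form[of 1 0] by simp
    then have "0 \<le> \<epsilon>" using pos by (simp add: zero_le_mult_iff)
    then show ?thesis using True pos by simp
  next
    case False
    have ab: "(cmod a)\<^sup>2 = Y" "(cmod b)\<^sup>2 = X"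
      using False pos by (auto simp: a_def b_def norm_mult norm_sgn power_mult_distrib)
    have "cnj (sgn d) * d = of_real (cmod d)" for d
    proof (cases "d = 0")
      case False
      have "cnj (sgn d) * d = d * cnj d / of_real (cmod d)" by (simp add: sgn_eq)
      also have "\<dots> = of_real ((cmod d)\<^sup>2 / cmod d)" by (simp only: complex_norm_square[symmetric] of_real_divide)
      finally show ?thesis by (simp add: power2_eq_square)
    qed simp
    from this[of "K - L"] have "cnj (sgn (K - L)) * (K - L) = of_real (cmod (K - L))" .
    then have "a * cnj b * (K - L) = of_real (s * cmod (K - L))"
      unfolding a_def b_def s_def by (simp add: ac_simps)
    then have "Re (a * cnj b * (K - L)) = s * cmod (K - L)" by (simp only: Re_complex_of_real)
    then have "Re (a * cnj b * K) - Re (a * cnj b * L) = s * cmod (K - L)"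
      by (simp only: right_diff_distrib minus_complex.sel)
    moreover define k where "k = Re (a * cnj b * K)"
    moreover define l where "l = Re (a * cnj b * L)"
    ultimately have kl: "k - l = s * cmod (K - L)" by simp
    have 1: "Y * x + X * y + 2 * k - (Y * X + X * Y + 2 * l) \<le> \<epsilon> * (Y * X + X * Y + 2 * l)"
      using form[of a b] unfolding ab k_def l_def by linarith
    have neg: "Re (a * cnj (- b) * K) = - k" "Re (a * cnj (- b) * L) = - l"
      unfolding k_def l_def by simp_all
    have "\<bar>(Y * x + X * y + 2 * (- k)) - (Y * X + X * Y + 2 * (- l))\<bar> \<le> \<epsilon> * (Y * X + X * Y + 2 * (- l))"
      using form[of a "- b"] unfolding norm_minus_cancel ab neg .
    then have 2: "Y * X + X * Y - 2 * l - (Y * x + X * y - 2 * k) \<le> \<epsilon> * (Y * X + X * Y - 2 * l)"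
      by (simp add: abs_le_iff)
    have "4 * (k - l) \<le> 4 * \<epsilon> * (X * Y)" using 1 2 by (simp add: algebra_simps)
    then have "s * cmod (K - L) \<le> s * (\<epsilon> * s)" unfolding kl s(2) by (simp add: algebra_simps)
    then have "cmod (K - L) \<le> \<epsilon> * s" using s(1) by (rule mult_left_le_imp_le)
    then show ?thesis by (simp only: s_def mult.assoc)
  qed
qed

text \<open>
  Dropping the vanishing leading coefficients gives a nonzero polynomial its degree; for the
  zero polynomial both norms vanish.
\<close>

lemma norm_L2_bounds_lin_combs:
  assumes deg: "\<And>p k. has_degree \<alpha> p k \<Longrightarrow> k \<le> N \<Longrightarrow>
       (1 - \<epsilon>) * (norm_L2 \<mu> p)\<^sup>2 \<le> (norm_L2 \<nu> p)\<^sup>2 \<and> (norm_L2 \<nu> p)\<^sup>2 \<le> (1 + \<epsilon>) * (norm_L2 \<mu> p)\<^sup>2"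
    and p: "p \<in> lin_combs (\<lambda>l. monomial (\<alpha> l)) {..N}"
  shows "(1 - \<epsilon>) * (norm_L2 \<mu> p)\<^sup>2 \<le> (norm_L2 \<nu> p)\<^sup>2 \<and> (norm_L2 \<nu> p)\<^sup>2 \<le> (1 + \<epsilon>) * (norm_L2 \<mu> p)\<^sup>2"
proof -
  obtain c where c: "p = (\<lambda>z. \<Sum>l\<le>N. c l * monomial (\<alpha> l) z)" using p unfolding lin_combs_def by blast
  let ?J = "{l. l \<le> N \<and> c l \<noteq> 0}"
  show ?thesis
  proof (cases "?J = {}")
    case True
    then have "p = (\<lambda>z. 0)" unfolding c by (intro ext sum.neutral) auto
    then show ?thesis by (simp add: norm_L2_sq)
  next
    case False
    define k where "k = Max ?J"
    have k: "k \<le> N" "c k \<noteq> 0" using Max_in[of ?J] False unfolding k_def by auto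
    have zero: "c l = 0" if "k < l" "l \<le> N" for l
    proof (rule ccontr)
      assume "c l \<noteq> 0"
      then have "l \<in> ?J" using that by simp
      then have "l \<le> k" unfolding k_def by (intro Max_ge) auto
      then show False using that by simp
    qed
    have "p = (\<lambda>z. \<Sum>l\<le>k. c l * monomial (\<alpha> l) z)"
      unfolding c using k zero by (intro ext sum.mono_neutral_right) (auto simp: not_le)
    then have "has_degree \<alpha> p k" using k unfolding has_degree_def by blast
    then show ?thesis using deg k by blast
  qed
qed

lemma orthopoly_in_monomials:
  assumes "compact_borel_measure \<mu>" and "index_defined \<alpha> \<mu> n" and "j \<le> n"
  shows "orthopoly \<alpha> \<mu> j \<in> lin_combs (\<lambda>l. monomial (\<alpha> l)) {..index \<alpha> \<mu> n}"
proof (rule lin_combs_trans[OF orthopoly_in_index_monomials])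
  fix i assume "i \<in> {..j}"
  then have "index \<alpha> \<mu> i \<le> index \<alpha> \<mu> n" using assms by (intro index_mono) auto
  then show "index_monomial \<alpha> \<mu> i \<in> lin_combs (\<lambda>l. monomial (\<alpha> l)) {..index \<alpha> \<mu> n}"
    by (intro lin_combs_base[of _ _ "\<lambda>l. monomial (\<alpha> l)"]) auto
qed

text \<open>
  The orthonormal polynomials of the two measures span the same space, because that space is
  spanned by the monomials with the same indices.
\<close>

lemma orthopoly_in_orthopoly:
  assumes "compact_borel_measure \<mu>" and "index_defined \<alpha> \<mu> n"
    and eq: "\<And>j. j \<le> n \<Longrightarrow> index \<alpha> \<nu> j = index \<alpha> \<mu> j" and "j \<le> n"
  shows "orthopoly \<alpha> \<nu> j \<in> lin_combs (orthopoly \<alpha> \<mu>) {..n}"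
proof (rule lin_combs_trans[OF orthopoly_in_index_monomials])
  fix i assume i: "i \<in> {..j}"
  then have "index_monomial \<alpha> \<mu> i \<in> lin_combs (orthopoly \<alpha> \<mu>) {..n}"
    using norm_residual_nonzero[OF assms(1,2), of i] \<open>j \<le> n\<close>
    by (intro lin_combs_mono[OF _ _ index_monomial_in_orthopoly]) auto
  then show "index_monomial \<alpha> \<nu> i \<in> lin_combs (orthopoly \<alpha> \<mu>) {..n}"
    using eq[of i] i \<open>j \<le> n\<close> by simp
qed

text \<open>
  With \<open>s\<^sup>2 = X Y\<close>, \<open>t\<^sup>2 = x y\<close> and \<open>c = K / t\<close>, the difference \<open>c - L / s\<close> equals
  \<open>((K - L) + c (s - t)) / s\<close>. Each of the two terms is at most \<open>\<epsilon>\<close>: the second one because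
  \<open>\<bar>c\<bar> \<le> 1\<close> and \<open>t\<close> lies between \<open>(1 - \<epsilon>) s\<close> and \<open>(1 + \<epsilon>) s\<close>.
\<close>

lemma cosine_difference_le:
  fixes K L :: complex
  assumes "0 < X" "0 < Y" "0 \<le> x" "0 \<le> y" "0 \<le> \<epsilon>" "\<epsilon> \<le> 1"
    and x: "(1 - \<epsilon>) * X \<le> x" "x \<le> (1 + \<epsilon>) * X"
    and y: "(1 - \<epsilon>) * Y \<le> y" "y \<le> (1 + \<epsilon>) * Y"
    and KL: "cmod (K - L) \<le> \<epsilon> * sqrt X * sqrt Y" and K: "cmod K \<le> sqrt x * sqrt y"
  shows "cmod (K / of_real (sqrt x * sqrt y) - L / of_real (sqrt X * sqrt Y)) \<le> 2 * \<epsilon>"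
proof -
  define s where "s = sqrt X * sqrt Y"
  define t where "t = sqrt x * sqrt y"
  have s: "0 < s" using assms unfolding s_def by simp
  have "t\<^sup>2 = x * y" "s\<^sup>2 = X * Y" using assms unfolding s_def t_def by (auto simp: power_mult_distrib)
  moreover have "((1 - \<epsilon>) * X) * ((1 - \<epsilon>) * Y) \<le> x * y" "x * y \<le> ((1 + \<epsilon>) * X) * ((1 + \<epsilon>) * Y)"
    using assms by (auto intro!: mult_mono)
  moreover have sq: "((1 + e) * s)\<^sup>2 = ((1 + e) * X) * ((1 + e) * Y)" for e
    using \<open>s\<^sup>2 = X * Y\<close> by (simp add: power_mult_distrib) (simp add: power2_eq_square)
  ultimately have "((1 - \<epsilon>) * s)\<^sup>2 \<le> t\<^sup>2" "t\<^sup>2 \<le> ((1 + \<epsilon>) * s)\<^sup>2"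
    using sq[of \<epsilon>] sq[of "- \<epsilon>"] by simp_all
  moreover have "0 \<le> t" using assms unfolding t_def by simp
  ultimately have t: "(1 - \<epsilon>) * s \<le> t" "t \<le> (1 + \<epsilon>) * s"
    using s assms(5) by (auto intro: power2_le_imp_le)
  define c where "c = K / of_real t"
  have c1: "cmod c \<le> 1"
    using K \<open>0 \<le> t\<close> unfolding c_def t_def[symmetric] by (auto simp: norm_divide divide_le_eq_1)
  \<comment> \<open>For \<open>t = 0\<close> both sides vanish, since then \<open>K = 0\<close>.\<close>
  have K_eq: "K = c * of_real t"
    using K unfolding c_def t_def[symmetric] by (cases "t = 0") auto
  have "c - L / of_real s = ((K - L) + c * of_real (s - t)) / of_real s"
    unfolding K_eq using s by (simp add: field_simps)
  then have "cmod (c - L / of_real s) = cmod ((K - L) + c * of_real (s - t)) / s"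
    using s by (simp add: norm_divide)
  also have "\<dots> \<le> (\<epsilon> * s + \<epsilon> * s) / s"
  proof (intro divide_right_mono order_trans[OF norm_triangle_ineq] add_mono)
    show "cmod (K - L) \<le> \<epsilon> * s" using KL by (simp add: s_def mult.assoc)
    have "\<bar>s - t\<bar> \<le> \<epsilon> * s" using t by (simp add: abs_le_iff algebra_simps)
    then show "cmod (c * of_real (s - t)) \<le> \<epsilon> * s"
      using mult_mono[OF c1 \<open>\<bar>s - t\<bar> \<le> \<epsilon> * s\<close>] by (simp add: norm_mult del: of_real_diff)
  qed (use s in simp)
  also have "\<dots> = 2 * \<epsilon>" using s by simp
  finally show ?thesis unfolding c_def s_def t_def .
qed

theorem proposition3p7:
  fixes \<alpha> :: "nat \<Rightarrow> nat ^ 'd"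
    and \<mu> \<nu> :: "(complex ^ 'd) measure"
    and n :: nat and \<epsilon> :: real
  assumes "monomial_enumeration \<alpha>"
    and "compact_borel_measure \<mu>" and "compact_borel_measure \<nu>"
    and "index_defined \<alpha> \<mu> n"
    and "0 < \<epsilon>" and "\<epsilon> < 1"
    and "\<And>p k. has_degree \<alpha> p k \<Longrightarrow> k \<le> index \<alpha> \<mu> n \<Longrightarrow>
           (1 - \<epsilon>) * (norm_L2 \<mu> p)\<^sup>2 \<le> (norm_L2 \<nu> p)\<^sup>2 \<and>
           (norm_L2 \<nu> p)\<^sup>2 \<le> (1 + \<epsilon>) * (norm_L2 \<mu> p)\<^sup>2"
  shows "\<forall>z w.
           (1 - \<epsilon>) * CD_diag \<alpha> \<nu> n z \<le> CD_diag \<alpha> \<mu> n z \<and>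
           CD_diag \<alpha> \<mu> n z \<le> (1 + \<epsilon>) * CD_diag \<alpha> \<nu> n z \<and>
           cmod (CD_kernel \<alpha> \<mu> n z w - CD_kernel \<alpha> \<nu> n z w)
             \<le> \<epsilon> * sqrt (CD_diag \<alpha> \<nu> n z) * sqrt (CD_diag \<alpha> \<nu> n w) \<and>
           cmod (cosine_fun \<alpha> \<mu> n z w - cosine_fun \<alpha> \<nu> n z w) \<le> 2 * \<epsilon>"
proof (intro allI)
  fix z w
  note \<mu> = assms(2) and \<nu> = assms(3) and def\<mu> = assms(4) and \<epsilon> = assms(5,6)
  let ?N = "index \<alpha> \<mu> n"
  \<comment> \<open>As \<open>\<epsilon> < 1\<close>, both measures have the same null polynomials up to this degree, hence the same new degrees.\<close>
  have "norm_L2 \<mu> p = 0 \<longleftrightarrow> norm_L2 \<nu> p = 0" if "has_degree \<alpha> p k" "k \<le> ?N" for p k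
  proof
    assume "norm_L2 \<mu> p = 0"
    then have "(norm_L2 \<nu> p)\<^sup>2 \<le> 0" using assms(7)[OF that] by simp
    then show "norm_L2 \<nu> p = 0" by simp
  next
    assume "norm_L2 \<nu> p = 0"
    then have "(1 - \<epsilon>) * (norm_L2 \<mu> p)\<^sup>2 \<le> 0" using assms(7)[OF that] by simp
    then show "norm_L2 \<mu> p = 0" using \<epsilon> by (simp add: mult_le_0_iff)
  qed
  then have new: "new_degrees \<alpha> \<mu> \<inter> {..?N} = new_degrees \<alpha> \<nu> \<inter> {..?N}"
    unfolding new_degrees_def by auto
  have idx: "index \<alpha> \<nu> j = index \<alpha> \<mu> j" if "j \<le> n" for j
    by (rule index_eq[OF \<mu> def\<mu> \<nu> new that])
  have "card (new_degrees \<alpha> \<nu> \<inter> {..?N}) = n + 1"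
    using moment_rank_index[OF \<mu> def\<mu>, of n] by (simp add: moment_rank_eq[OF \<mu>] new)
  then have def\<nu>: "index_defined \<alpha> \<nu> n"
    unfolding index_defined_def moment_rank_eq[OF \<nu>] by blast

  let ?p = "orthopoly \<alpha> \<mu>" and ?q = "orthopoly \<alpha> \<nu>"
  have on\<mu>: "orthonormal_L2 \<mu> ?p {..n}"
    using orthonormal_orthopoly[OF \<mu>, of "Suc n"] norm_residual_nonzero[OF \<mu> def\<mu>]
    by (simp add: lessThan_Suc_atMost)
  have on\<nu>: "orthonormal_L2 \<nu> ?q {..n}"
    using orthonormal_orthopoly[OF \<nu>, of "Suc n"] norm_residual_nonzero[OF \<nu> def\<nu>]
    by (simp add: lessThan_Suc_atMost)
  have qp: "?q j \<in> lin_combs ?p {..n}" if "j \<in> {..n}" for j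
    using that by (intro orthopoly_in_orthopoly[OF \<mu> def\<mu>] idx) auto
  have pq: "?p j \<in> lin_combs ?q {..n}" if "j \<in> {..n}" for j
    using that by (intro orthopoly_in_orthopoly[OF \<nu> def\<nu>] idx[symmetric]) auto
  have bounds: "(1 - \<epsilon>) * (norm_L2 \<mu> p)\<^sup>2 \<le> (norm_L2 \<nu> p)\<^sup>2 \<and> (norm_L2 \<nu> p)\<^sup>2 \<le> (1 + \<epsilon>) * (norm_L2 \<mu> p)\<^sup>2"
    if "p \<in> lin_combs ?p {..n}" for p
  proof (rule norm_L2_bounds_lin_combs[OF assms(7)])
    show "p \<in> lin_combs (\<lambda>l. monomial (\<alpha> l)) {..?N}"
      by (rule lin_combs_trans[OF that]) (rule orthopoly_in_monomials[OF \<mu> def\<mu>], simp)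
  qed

  \<comment> \<open>The squared norms, with respect to \<open>\<mu>\<close> and \<open>\<nu>\<close>, of the functional \<open>p \<mapsto> a p(u) + b p(v)\<close>.\<close>
  define P where "P a b u v = (\<Sum>j\<le>n. (cmod (a * ?p j u + b * ?p j v))\<^sup>2)" for a b u v
  define Q where "Q a b u v = (\<Sum>j\<le>n. (cmod (a * ?q j u + b * ?q j v))\<^sup>2)" for a b u v
  have upper: "P a b u v \<le> (1 + \<epsilon>) * Q a b u v" for a b u v
    unfolding P_def Q_def
    using \<epsilon> bounds by (intro functional_norm_le[OF \<nu> \<mu> _ on\<nu> on\<mu> pq]) auto
  have "Q a b u v \<le> 1 / (1 - \<epsilon>) * P a b u v" for a b u v
    unfolding P_def Q_def
  proof (rule functional_norm_le[OF \<mu> \<nu> _ on\<mu> on\<nu> qp])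
    fix p assume "p \<in> lin_combs ?q {..n}"
    then have "p \<in> lin_combs ?p {..n}" using qp by (rule lin_combs_trans)
    then show "(norm_L2 \<mu> p)\<^sup>2 \<le> 1 / (1 - \<epsilon>) * (norm_L2 \<nu> p)\<^sup>2"
      using bounds \<epsilon> by (simp add: field_simps)
  qed (use \<epsilon> in auto)
  then have lower: "(1 - \<epsilon>) * Q a b u v \<le> P a b u v" for a b u v
    using \<epsilon> by (simp add: field_simps)
  have P: "P a b u v = (cmod a)\<^sup>2 * CD_diag \<alpha> \<mu> n u + (cmod b)\<^sup>2 * CD_diag \<alpha> \<mu> n v
     + 2 * Re (a * cnj b * CD_kernel \<alpha> \<mu> n u v)" for a b u v
    unfolding P_def by (rule sum_norm_sq_eq_CD)
  have Q: "Q a b u v = (cmod a)\<^sup>2 * CD_diag \<alpha> \<nu> n u + (cmod b)\<^sup>2 * CD_diag \<alpha> \<nu> n v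
     + 2 * Re (a * cnj b * CD_kernel \<alpha> \<nu> n u v)" for a b u v
    unfolding Q_def by (rule sum_norm_sq_eq_CD)

  have lo: "(1 - \<epsilon>) * CD_diag \<alpha> \<nu> n u \<le> CD_diag \<alpha> \<mu> n u" for u
    using lower[of 1 0 u u] unfolding P Q by simp
  have up: "CD_diag \<alpha> \<mu> n u \<le> (1 + \<epsilon>) * CD_diag \<alpha> \<nu> n u" for u
    using upper[of 1 0 u u] unfolding P Q by simp
  note nonneg = CD_diag_nonneg[of \<alpha> \<mu> n] CD_diag_nonneg[of \<alpha> \<nu> n]
  have "cmod (CD_kernel \<alpha> \<mu> n z w - CD_kernel \<alpha> \<nu> n z w)
             \<le> \<epsilon> * sqrt (CD_diag \<alpha> \<nu> n z) * sqrt (CD_diag \<alpha> \<nu> n w) \<and>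
           cmod (cosine_fun \<alpha> \<mu> n z w - cosine_fun \<alpha> \<nu> n z w) \<le> 2 * \<epsilon>"
  proof (cases "CD_diag \<alpha> \<nu> n z = 0 \<or> CD_diag \<alpha> \<nu> n w = 0")
    case True
    \<comment> \<open>If the orthonormal polynomials of one measure vanish at one of the points, so do those of the
      other. Both kernels and both cosines are then zero at \<open>(z, w)\<close>.\<close>
    moreover from True have "CD_diag \<alpha> \<mu> n z = 0 \<or> CD_diag \<alpha> \<mu> n w = 0"
      using up[of z] up[of w] nonneg(1)[of z] nonneg(1)[of w] by auto
    ultimately have "CD_kernel \<alpha> \<mu> n z w = 0" "CD_kernel \<alpha> \<nu> n z w = 0"
      using cmod_CD_kernel_le[of \<alpha> \<mu> n z w] cmod_CD_kernel_le[of \<alpha> \<nu> n z w] by auto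
    then show ?thesis using \<epsilon> nonneg by (simp add: cosine_fun_def)
  next
    case False
    then have pos: "0 < CD_diag \<alpha> \<nu> n z" "0 < CD_diag \<alpha> \<nu> n w"
      using nonneg(2)[of z] nonneg(2)[of w] by auto
    have "\<bar>P a b z w - Q a b z w\<bar> \<le> \<epsilon> * Q a b z w" for a b
      using lower[of a b z w] upper[of a b z w] by (simp add: abs_le_iff algebra_simps)
    then have KL: "cmod (CD_kernel \<alpha> \<mu> n z w - CD_kernel \<alpha> \<nu> n z w)
             \<le> \<epsilon> * sqrt (CD_diag \<alpha> \<nu> n z) * sqrt (CD_diag \<alpha> \<nu> n w)"
      unfolding P Q by (rule hermitian_perturbation_le[OF _ pos])
    then show ?thesis
      unfolding cosine_fun_def
      using cosine_difference_le[OF pos nonneg(1) nonneg(1) _ _ lo up lo up KL cmod_CD_kernel_le] \<epsilon> by simp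
  qed
  then show "(1 - \<epsilon>) * CD_diag \<alpha> \<nu> n z \<le> CD_diag \<alpha> \<mu> n z \<and>
           CD_diag \<alpha> \<mu> n z \<le> (1 + \<epsilon>) * CD_diag \<alpha> \<nu> n z \<and>
           cmod (CD_kernel \<alpha> \<mu> n z w - CD_kernel \<alpha> \<nu> n z w)
             \<le> \<epsilon> * sqrt (CD_diag \<alpha> \<nu> n z) * sqrt (CD_diag \<alpha> \<nu> n w) \<and>
           cmod (cosine_fun \<alpha> \<mu> n z w - cosine_fun \<alpha> \<nu> n z w) \<le> 2 * \<epsilon>"
    using lo up by blast
qed

end
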